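(* Let $n\ge1$ and $1\le M\le 2^{n-1}$ be integers and set $a:=M/2^{n}$ (so $0<a\le 1/2$). Then every $A\subseteq\{-1,1\}^{n}$ with $|A|=M$ satisfies \[ D(A)\;\ge\;\frac{n}{2}-\varphi(a),\qquad\text{where }\ \varphi(a):=\begin{cases}\frac{1}{\sqrt{a}}-1, & 0< a\le\frac14,\\[2pt] \frac{1}{4a}, & \frac14<a\le\frac12.\end{cases} \]
   Context: For a nonempty set (code) $A\subseteq\{-1,1\}^{n}$, its average distance is $D(A):=\frac{1}{|A|^{2}}\sum_{(\mathbf{x},\mathbf{x}')\in A^{2}}d_{\mathrm{H}}(\mathbf{x},\mathbf{x}')$, where $d_{\mathrm{H}}(\mathbf{x},\mathbf{x}')=|\{i:x_i\neq x_i'\}|$ is the Hamming distance. *)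

theory Defs
  imports Complex_Main
begin

definition cube :: "nat \<Rightarrow> int list set" where
  "cube n = {x. length x = n \<and> set x \<subseteq> {-1, 1}}"

definition hamming :: "int list \<Rightarrow> int list \<Rightarrow> nat" where
  "hamming x y = card {i. i < length x \<and> x ! i \<noteq> y ! i}"

definition avg_dist :: "int list set \<Rightarrow> real" where
  "avg_dist A = (\<Sum>(x, y) \<in> A \<times> A. real (hamming x y)) / (real (card A))^2"

definition phi :: "real \<Rightarrow> real" where
  "phi a = (if a \<le> 1/4 then 1 / sqrt a - 1 else 1 / (4 * a))"

end

theory Submission
  imports Defs
begin

text \<open>
  The indicator of \<open>A\<close> correlates nonnegatively with its image under the noise operator of
  \<^emph>\<open>negative\<close> correlation \<open>-q\<close>, since its kernel \<open>\<Prod>i. 1 - q x\<^sub>i y\<^sub>i\<close> is nonnegative for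
  \<open>0 \<le> q \<le> 1\<close>. On the Fourier side, bounding \<open>(-q)^k \<le> q\<^sup>2\<close> for \<open>k \<ge> 2\<close> and using Parseval
  turns this into an upper bound on the level-1 weight, and \<open>D(A)\<close> is \<open>n/2\<close> minus half the
  normalised level-1 weight. The choice \<open>q = \<surd>a / (1 - \<surd>a)\<close> is optimal for \<open>a \<le> 1/4\<close>, and
  \<open>q = 1\<close> gives the bound for \<open>a > 1/4\<close>.
\<close>

text \<open>For \<open>A\<close> in the cube and \<open>S\<close> a set of coordinates this is
  \<open>4 ^ n\<close> times the squared Fourier coefficient at \<open>S\<close> of the indicator of
  \<open>A\<close>. Leaving out the normalisation keeps \<open>n\<close> out of the
  definition.\<close>

definition fourier_weight :: "int list set \<Rightarrow> nat set \<Rightarrow> real" where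
  "fourier_weight A S = (\<Sum>x\<in>A. \<Prod>i\<in>S. real_of_int (x ! i))\<^sup>2"

lemma fourier_weight_nonneg: "fourier_weight A S \<ge> 0"
  by (simp add: fourier_weight_def)

lemma fourier_weight_empty: "fourier_weight A {} = (real (card A))\<^sup>2"
  by (simp add: fourier_weight_def)

lemma fourier_weight_eq:
  "fourier_weight A S = (\<Sum>x\<in>A. \<Sum>y\<in>A. \<Prod>i\<in>S. real_of_int (x ! i) * real_of_int (y ! i))"
  by (simp add: fourier_weight_def power2_eq_square sum_product prod.distrib)

text \<open>Expand the product over subsets \<open>S\<close> of the coordinates and exchange the
  sums. No sign or size of \<open>s\<close> is assumed: \<open>s = 1\<close> yields Parseval and
  \<open>s = - q\<close> the main inequality.\<close>

lemma noise_kernel_sum: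
  "(\<Sum>x\<in>A. \<Sum>y\<in>A. \<Prod>i<n. 1 + s * (real_of_int (x ! i) * real_of_int (y ! i))) =
   (\<Sum>S\<in>Pow {..<n}. s ^ card S * fourier_weight A S)"
proof -
  have "(\<Prod>i<n. 1 + s * (real_of_int (x ! i) * real_of_int (y ! i))) =
      (\<Sum>S\<in>Pow {..<n}. s ^ card S * (\<Prod>i\<in>S. real_of_int (x ! i) * real_of_int (y ! i)))"
    for x y :: "int list"
    using prod_add[of "{..<n}" "\<lambda>i. s * (real_of_int (x ! i) * real_of_int (y ! i))" "\<lambda>_. 1"]
    by (simp add: prod.distrib add.commute)
  then have "(\<Sum>x\<in>A. \<Sum>y\<in>A. \<Prod>i<n. 1 + s * (real_of_int (x ! i) * real_of_int (y ! i))) =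
     (\<Sum>x\<in>A. \<Sum>S\<in>Pow {..<n}. \<Sum>y\<in>A. s ^ card S * (\<Prod>i\<in>S. real_of_int (x ! i) * real_of_int (y ! i)))"
    by (simp add: sum.swap[of _ "Pow {..<n}" A])
  also have "\<dots> = (\<Sum>S\<in>Pow {..<n}. s ^ card S * fourier_weight A S)"
    by (subst sum.swap) (simp add: fourier_weight_eq sum_distrib_left)
  finally show ?thesis .
qed

lemma cube_nth: "x \<in> cube n \<Longrightarrow> i < n \<Longrightarrow> x ! i = -1 \<or> x ! i = 1"
  unfolding cube_def using nth_mem by fastforce

lemma finite_cube: "finite (cube n)"
  using finite_lists_length_eq[of "{-1, 1::int}" n] by (simp add: cube_def conj_commute)

text \<open>At \<open>s = 1\<close> the kernel is concentrated on the diagonal: a coordinate where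
  \<open>x\<close> and \<open>y\<close> differ contributes a factor 0, while for
  \<open>x = y\<close> all \<open>n\<close> factors are 2.\<close>

lemma parseval:
  assumes "A \<subseteq> cube n"
  shows "(\<Sum>S\<in>Pow {..<n}. fourier_weight A S) = 2 ^ n * real (card A)"
proof -
  have fin: "finite A"
    using assms finite_cube finite_subset by blast
  have "(\<Prod>i<n. 1 + real_of_int (x ! i) * real_of_int (y ! i)) = (if x = y then 2 ^ n else 0)"
    if "x \<in> A" "y \<in> A" for x y
  proof (cases "x = y")
    case True
    have "1 + real_of_int (x ! i) * real_of_int (x ! i) = 2" if "i < n" for i
      using cube_nth[OF subsetD[OF assms \<open>x \<in> A\<close>] that] by auto
    with True show ?thesis by simp
  next
    case False
    have len: "length x = n" "length y = n"
      using that assms by (auto simp: cube_def)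
    then obtain i where i: "i < n" "x ! i \<noteq> y ! i"
      using False by (auto simp: list_eq_iff_nth_eq)
    then have "1 + real_of_int (x ! i) * real_of_int (y ! i) = 0"
      using cube_nth[OF subsetD[OF assms], of x i] cube_nth[OF subsetD[OF assms], of y i] that by auto
    with i(1) False show ?thesis by auto
  qed
  then have "(\<Sum>x\<in>A. \<Sum>y\<in>A. \<Prod>i<n. 1 + real_of_int (x ! i) * real_of_int (y ! i)) =
      (\<Sum>x\<in>A. \<Sum>y\<in>A. if x = y then 2 ^ n else 0)"
    by simp
  with fin show ?thesis
    using noise_kernel_sum[where s = 1 and A = A and n = n] by (simp add: mult.commute)
qed

text \<open>For signs, the product of two coordinates is 1 if they agree and -1 otherwise, so the
  inner product of \<open>x\<close> and \<open>y\<close> is affine in their Hamming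
  distance.\<close>

lemma level_one_weight:
  assumes "A \<subseteq> cube n"
  shows "(\<Sum>i<n. fourier_weight A {i}) = (real (card A))\<^sup>2 * (real n - 2 * avg_dist A)"
proof -
  have *: "(\<Sum>i<n. real_of_int (x ! i) * real_of_int (y ! i)) = real n - 2 * real (hamming x y)"
    if "x \<in> A" "y \<in> A" for x y
  proof -
    have "(\<Sum>i<n. real_of_int (x ! i) * real_of_int (y ! i)) =
        (\<Sum>i<n. 1 - 2 * (if x ! i \<noteq> y ! i then 1 else 0))"
      using that assms cube_nth[of x n] cube_nth[of y n] by (intro sum.cong) fastforce+
    also have "\<dots> = real n - 2 * (\<Sum>i<n. if x ! i \<noteq> y ! i then 1 else 0)"
      by (simp only: sum_subtractf sum_distrib_left[symmetric]) simp
    also have "(\<Sum>i<n. if x ! i \<noteq> y ! i then 1 else 0) = real (hamming x y)"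
    proof -
      have "length x = n"
        using that assms by (auto simp: cube_def)
      moreover have "{i \<in> {..<n}. x ! i \<noteq> y ! i} = {i. i < n \<and> x ! i \<noteq> y ! i}"
        by auto
      ultimately show ?thesis
        by (simp add: hamming_def sum.inter_filter[symmetric])
    qed
    finally show ?thesis .
  qed
  have "(\<Sum>i<n. fourier_weight A {i}) =
      (\<Sum>x\<in>A. \<Sum>y\<in>A. \<Sum>i<n. real_of_int (x ! i) * real_of_int (y ! i))"
    by (simp add: fourier_weight_eq sum.swap[of _ "{..<n}" A])
  also have "\<dots> = (\<Sum>x\<in>A. \<Sum>y\<in>A. real n - 2 * real (hamming x y))"
    using * by simp
  also have "\<dots> = (real (card A))\<^sup>2 * real n - 2 * (\<Sum>x\<in>A. \<Sum>y\<in>A. real (hamming x y))"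
    by (simp add: sum_subtractf sum_distrib_left power2_eq_square)
  also have "\<dots> = (real (card A))\<^sup>2 * (real n - 2 * avg_dist A)"
  proof (cases "card A = 0")
    \<comment> \<open>For empty \<open>A\<close> the average is a division by zero, but the factor
      \<open>card A\<close> makes both sides 0.\<close>
    case True
    then have "A = {}"
      using assms finite_cube finite_subset by fastforce
    then show ?thesis by simp
  next
    case False
    then show ?thesis
      by (simp add: avg_dist_def sum.cartesian_product field_simps)
  qed
  finally show ?thesis .
qed

lemma neg_noise_power_le:
  fixes q :: real
  assumes "0 \<le> q" "q \<le> 1" "k \<ge> 2"
  shows "(- q) ^ k \<le> q\<^sup>2"
proof -
  have "(- q) ^ k \<le> \<bar>(- q) ^ k\<bar>" by (rule abs_ge_self)
  also have "\<dots> = q ^ k" using assms by (simp add: power_abs)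
  also have "\<dots> \<le> q\<^sup>2" using assms by (intro power_decreasing) auto
  finally show ?thesis .
qed

lemma level_one_weight_le:
  assumes A: "A \<subseteq> cube n" and q: "0 \<le> q" "q \<le> 1"
  defines "W \<equiv> \<Sum>i<n. fourier_weight A {i}"
  shows "q * (1 + q) * W \<le> (1 - q\<^sup>2) * (real (card A))\<^sup>2 + q\<^sup>2 * (2 ^ n * real (card A))"
proof -
  \<comment> \<open>Levels 0 and 1 are kept exactly; only the levels collected here are
    estimated.\<close>
  define \<C> where "\<C> = {S \<in> Pow {..<n}. card S \<ge> 2}"
  have fin: "finite \<C>" by (simp add: \<C>_def)
  have Pow_eq: "Pow {..<n} = insert {} ((\<lambda>i. {i}) ` {..<n} \<union> \<C>)"
  proof -
    have "S = {} \<or> S \<in> (\<lambda>i. {i}) ` {..<n} \<or> card S \<ge> 2" if "S \<subseteq> {..<n}" for S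
    proof -
      have "finite S" using that finite_subset by blast
      moreover have "card S = 0 \<or> card S = 1 \<or> card S \<ge> 2" by linarith
      ultimately show ?thesis
        using that by (auto simp: card_1_singleton_iff)
    qed
    then show ?thesis by (auto simp: \<C>_def)
  qed
  have split: "(\<Sum>S\<in>Pow {..<n}. g S) = g {} + (\<Sum>i<n. g {i}) + (\<Sum>S\<in>\<C>. g S)"
    for g :: "nat set \<Rightarrow> real"
  proof -
    have "{} \<notin> (\<lambda>i. {i}) ` {..<n} \<union> \<C>" "(\<lambda>i. {i}) ` {..<n} \<inter> \<C> = {}"
      by (auto simp: \<C>_def)
    then show ?thesis
      using fin unfolding Pow_eq
      by (subst sum.insert) (auto simp: sum.union_disjoint sum.reindex)
  qed
  \<comment> \<open>Each factor is \<open>1 - q\<close> or \<open>1 + q\<close>; this is where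
    \<open>q \<le> 1\<close> makes the kernel nonnegative.\<close>
  have "0 \<le> (\<Sum>x\<in>A. \<Sum>y\<in>A. \<Prod>i<n. 1 + (- q) * (real_of_int (x ! i) * real_of_int (y ! i)))"
  proof (intro sum_nonneg prod_nonneg ballI)
    fix x y i assume "x \<in> A" "y \<in> A" "i \<in> {..<n}"
    then show "0 \<le> 1 + (- q) * (real_of_int (x ! i) * real_of_int (y ! i))"
      using cube_nth[OF subsetD[OF A], of x i] cube_nth[OF subsetD[OF A], of y i] q by auto
  qed
  also have "\<dots> = (\<Sum>S\<in>Pow {..<n}. (- q) ^ card S * fourier_weight A S)"
    by (rule noise_kernel_sum)
  also have "\<dots> = (real (card A))\<^sup>2 - q * W + (\<Sum>S\<in>\<C>. (- q) ^ card S * fourier_weight A S)"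
    by (simp add: split W_def fourier_weight_empty sum_distrib_left sum_negf)
  also have "(\<Sum>S\<in>\<C>. (- q) ^ card S * fourier_weight A S) \<le> (\<Sum>S\<in>\<C>. q\<^sup>2 * fourier_weight A S)"
    using q by (intro sum_mono mult_right_mono neg_noise_power_le fourier_weight_nonneg)
      (auto simp: \<C>_def)
  \<comment> \<open>Parseval gives the weight above level 1 as the total minus levels 0 and 1. The
    new term in \<open>W\<close> joins \<open>- q * W\<close> to form the factor
    \<open>q * (1 + q)\<close>.\<close>
  also have "\<dots> = q\<^sup>2 * (2 ^ n * real (card A) - (real (card A))\<^sup>2 - W)"
    using parseval[OF A] split[of "fourier_weight A"]
    by (simp add: W_def fourier_weight_empty flip: sum_distrib_left)
  finally show ?thesis
    by (simp add: algebra_simps power2_eq_square)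
qed

theorem theorem1:
  fixes n M :: nat and A :: "int list set"
  assumes "n \<ge> 1" and "1 \<le> M" and "M \<le> 2 ^ (n - 1)"
    and "A \<subseteq> cube n" and "card A = M"
  shows "avg_dist A \<ge> real n / 2 - phi (real M / 2 ^ n)"
proof -
  define a where "a = real M / 2 ^ n"
  define X where "X = real n / 2 - avg_dist A"
  have a: "a > 0" using assms by (simp add: a_def)
  \<comment> \<open>The level-1 weight is \<open>2 * M^2 * X\<close>; dividing the previous lemma by
    \<open>M^2\<close> turns \<open>2 ^ n / M\<close> into \<open>1 / a\<close>.\<close>
  have bound: "2 * (q * (1 + q)) * X \<le> 1 - q\<^sup>2 + q\<^sup>2 / a" if q: "0 \<le> q" "q \<le> 1" for q
  proof -
    have "(real M)\<^sup>2 * (2 * (q * (1 + q)) * X) \<le> (1 - q\<^sup>2) * (real M)\<^sup>2 + q\<^sup>2 * (2 ^ n * real M)"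
      using level_one_weight_le[OF assms(4) q] level_one_weight[OF assms(4)] assms(5)
      by (simp add: X_def algebra_simps)
    also have "\<dots> = (real M)\<^sup>2 * (1 - q\<^sup>2 + q\<^sup>2 / a)"
      using assms(2) by (simp add: a_def field_simps power2_eq_square)
    finally show ?thesis
      using assms(2) by simp
  qed
  have "X \<le> phi a"
  proof (cases "a \<le> 1 / 4")
    case True
    define s where "s = sqrt a"
    have s: "s > 0" "s \<le> 1 / 2" "a = s\<^sup>2"
      using a True real_sqrt_le_mono[OF True] by (simp_all add: s_def real_sqrt_divide)
    \<comment> \<open>This is the critical point in \<open>q\<close> of the resulting upper bound on
      \<open>X\<close>. It is at most 1 exactly when \<open>s \<le> 1 / 2\<close>, whence the
      threshold 1/4 for \<open>a\<close>.\<close>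
    define q where "q = s / (1 - s)"
    have "0 \<le> q" "q \<le> 1"
      using s by (auto simp: q_def field_simps)
    note bound[OF this]
    moreover have "q * (1 + q) = s / (1 - s)\<^sup>2"
      using s by (simp add: q_def field_simps power2_eq_square)
    moreover have "1 - q\<^sup>2 + q\<^sup>2 / a = 2 * (1 - s) / (1 - s)\<^sup>2"
    proof -
      have "q\<^sup>2 = s\<^sup>2 / (1 - s)\<^sup>2" "q\<^sup>2 / a = 1 / (1 - s)\<^sup>2" "(1 - s)\<^sup>2 \<noteq> 0"
        using s by (simp_all add: q_def power_divide)
      then have "1 - q\<^sup>2 + q\<^sup>2 / a = ((1 - s)\<^sup>2 - s\<^sup>2 + 1) / (1 - s)\<^sup>2"
        by (simp add: add_divide_distrib diff_divide_distrib)
      then show ?thesis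
        by (simp add: power2_eq_square algebra_simps)
    qed
    \<comment> \<open>Both sides of the bound carry the positive factor
      \<open>2 / (1 - s)^2\<close>, which cancels.\<close>
    ultimately have "s * X \<le> 1 - s"
      using s by (simp add: divide_le_cancel)
    then show ?thesis
      using s True by (simp add: phi_def s_def[symmetric] field_simps)
  next
    case False
    \<comment> \<open>The critical point now exceeds 1, so the endpoint \<open>q = 1\<close> is
      taken, where the bound reads \<open>4 * X \<le> 1 / a\<close>.\<close>
    then show ?thesis
      using bound[of 1] a by (simp add: phi_def field_simps)
  qed
  then show ?thesis by (simp add: X_def a_def)
qed

end
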